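(* Let $(\mathcal{M}, g, A)$ be a K\"ahler manifold with a quarter-symmetric metric $A$-connection $\overset{1}{\nabla}_XY=\overset{g}{\nabla}_XY-\pi(X)AY$ with generator $\pi$. The tensor $$\overset{1}{H}(X,Y)Z=\overset{1}{R}(X,Y)Z+\overset{1}{R}ic(Y,AX)\,AZ$$ is independent of the generator $\pi$; that is, for any two 1-forms $\pi,\tilde\pi$ on $\mathcal{M}$, the tensors $\overset{1}{H}$ constructed from $\pi$ and from $\tilde\pi$ coincide.
   Context: A K\"ahler manifold $(\mathcal{M},g,A)$ is a Riemannian manifold $(\mathcal{M},g)$ of dimension $n=2k\ge4$ with a $(1,1)$ tensor field $A$ satisfying $A^2=-I$, $g(AX,AY)=g(X,Y)$ and $\overset{g}{\nabla}A=0$, where $\overset{g}{\nabla}$ is the Levi-Civita connection. $\overset{g}{R}$ is the Riemannian curvature tensor of $g$, $\overset{g}{R}(X,Y)Z=\overset{g}{\nabla}_X\overset{g}{\nabla}_YZ-\overset{g}{\nabla}_Y\overset{g}{\nabla}_XZ-\overset{g}{\nabla}_{[X,Y]}Z$. For a 1-form $\pi$ (the generator), the curvature tensor of the first kind is the curvature tensor of $\overset{1}{\nabla}$, given by $$\overset{1}{R}(X,Y)Z=\overset{g}{R}(X,Y)Z-\overset{1}{D}(X,Y)AZ,\qquad \overset{1}{D}(X,Y)=(\overset{g}{\nabla}_X\pi)(Y)-(\overset{g}{\nabla}_Y\pi)(X).$$ Its Ricci tensor is $\overset{1}{R}ic(Y,Z)=\mathrm{Trace}\{X\mapsto\overset{1}{R}(X,Y)Z\}$.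 *)

theory Defs
  imports "HOL-Analysis.Analysis"
begin

section \<open>Smooth manifolds and vector fields\<close>

text \<open>Only used for open \<open>S\<close>. On a finite-dimensional domain this is the usual
  \<open>C\<^sup>k\<close>: all iterated directional derivatives up to order \<open>k\<close> exist and are continuous.\<close>

primrec Ck_on ::
  "nat \<Rightarrow> 'a::real_normed_vector set \<Rightarrow> ('a \<Rightarrow> 'b::real_normed_vector) \<Rightarrow> bool" where
  "Ck_on 0 S f \<longleftrightarrow> continuous_on S f"
| "Ck_on (Suc k) S f \<longleftrightarrow> f differentiable_on S \<and>
     (\<forall>v. Ck_on k S (\<lambda>x. frechet_derivative f (at x) v))"

definition Cinf_on :: "'a::real_normed_vector set \<Rightarrow> ('a \<Rightarrow> 'b::real_normed_vector) \<Rightarrow> bool" where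
  "Cinf_on S f \<longleftrightarrow> (\<forall>k. Ck_on k S f)"

text \<open>The manifold is the whole type \<open>'m\<close>; a chart is an open domain together with a map
  that matters only on that domain.\<close>

type_synonym ('m, 'n) chart = "'m set \<times> ('m \<Rightarrow> real ^ 'n)"

definition smooth_atlas ::
  "('m::{t2_space, second_countable_topology}, 'n::finite) chart set \<Rightarrow> bool" where
  "smooth_atlas \<A> \<longleftrightarrow>
     (\<forall>(U, \<phi>)\<in>\<A>. open U \<and> open (\<phi> ` U) \<and> homeomorphism U (\<phi> ` U) \<phi> (inv_into U \<phi>)) \<and>
     (\<Union>(U, \<phi>)\<in>\<A>. U) = UNIV \<and>
     (\<forall>(U, \<phi>)\<in>\<A>. \<forall>(V, \<psi>)\<in>\<A>. Cinf_on (\<phi> ` (U \<inter> V)) (\<psi> \<circ> inv_into U \<phi>))"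

definition smooth_fun ::
  "('m::topological_space, 'n::finite) chart set \<Rightarrow> 'm set \<Rightarrow> ('m \<Rightarrow> real) \<Rightarrow> bool" where
  "smooth_fun \<A> U f \<longleftrightarrow> (\<forall>(V, \<phi>)\<in>\<A>. Cinf_on (\<phi> ` (U \<inter> V)) (f \<circ> inv_into V \<phi>))"

text \<open>Each tangent space is identified with \<open>\<real>\<^sup>n\<close> by the differential of one
  chart \<open>\<phi>\<close> around \<open>p\<close>, chosen once and for all: \<open>v :: real ^ 'n\<close> stands for the tangent vector
  with components \<open>v $ i\<close> in the coordinate basis of \<open>\<phi>\<close> at \<open>p\<close>, that is, for the derivation
  \<open>f \<mapsto> d(f \<circ> \<phi>\<^sup>-\<^sup>1)(\<phi> p) v\<close>. The choice may jump
  from point to point, so smoothness of a vector field is never smoothness of its components; it is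
  defined through the action on smooth functions.\<close>

definition chart_at :: "('m, 'n::finite) chart set \<Rightarrow> 'm \<Rightarrow> ('m, 'n) chart" where
  "chart_at \<A> p = (SOME c. c \<in> \<A> \<and> p \<in> fst c)"

definition dir_deriv ::
  "('m, 'n::finite) chart set \<Rightarrow> 'm \<Rightarrow> real ^ 'n \<Rightarrow> ('m \<Rightarrow> real) \<Rightarrow> real" where
  "dir_deriv \<A> p v f =
     (case chart_at \<A> p of (U, \<phi>) \<Rightarrow> frechet_derivative (f \<circ> inv_into U \<phi>) (at (\<phi> p)) v)"

type_synonym ('m, 'n) vfield = "'m \<Rightarrow> real ^ 'n"

definition act ::
  "('m, 'n::finite) chart set \<Rightarrow> ('m, 'n) vfield \<Rightarrow> ('m \<Rightarrow> real) \<Rightarrow> 'm \<Rightarrow> real" where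
  "act \<A> X f p = dir_deriv \<A> p (X p) f"

definition smooth_vfield ::
  "('m::topological_space, 'n::finite) chart set \<Rightarrow> 'm set \<Rightarrow> ('m, 'n) vfield \<Rightarrow> bool" where
  "smooth_vfield \<A> U X \<longleftrightarrow>
     (\<forall>V f. open V \<and> V \<subseteq> U \<and> smooth_fun \<A> V f \<longrightarrow> smooth_fun \<A> V (act \<A> X f))"

definition lie_bracket ::
  "('m::topological_space, 'n::finite) chart set \<Rightarrow>
   ('m, 'n) vfield \<Rightarrow> ('m, 'n) vfield \<Rightarrow> ('m, 'n) vfield" where
  "lie_bracket \<A> X Y p =
     (THE v. \<forall>U f. open U \<and> p \<in> U \<and> smooth_fun \<A> U f \<longrightarrow>
        dir_deriv \<A> p v f = act \<A> X (act \<A> Y f) p - act \<A> Y (act \<A> X f) p)"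

section \<open>Tensor fields\<close>

type_synonym ('m, 'n) form1 = "'m \<Rightarrow> real ^ 'n \<Rightarrow> real"
type_synonym ('m, 'n) tensor11 = "'m \<Rightarrow> real ^ 'n \<Rightarrow> real ^ 'n"
type_synonym ('m, 'n) tensor02 = "'m \<Rightarrow> real ^ 'n \<Rightarrow> real ^ 'n \<Rightarrow> real"

definition one_form ::
  "('m::topological_space, 'n::finite) chart set \<Rightarrow> ('m, 'n) form1 \<Rightarrow> bool" where
  "one_form \<A> \<pi> \<longleftrightarrow> (\<forall>p. linear (\<pi> p)) \<and>
     (\<forall>U X. open U \<and> smooth_vfield \<A> U X \<longrightarrow> smooth_fun \<A> U (\<lambda>p. \<pi> p (X p)))"

definition tensor_field11 ::
  "('m::topological_space, 'n::finite) chart set \<Rightarrow> ('m, 'n) tensor11 \<Rightarrow> bool" where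
  "tensor_field11 \<A> A \<longleftrightarrow> (\<forall>p. linear (A p)) \<and>
     (\<forall>U X. open U \<and> smooth_vfield \<A> U X \<longrightarrow> smooth_vfield \<A> U (\<lambda>p. A p (X p)))"

definition riemannian_metric ::
  "('m::topological_space, 'n::finite) chart set \<Rightarrow> ('m, 'n) tensor02 \<Rightarrow> bool" where
  "riemannian_metric \<A> g \<longleftrightarrow>
     (\<forall>p. bilinear (g p) \<and> (\<forall>v w. g p v w = g p w v) \<and> (\<forall>v. v \<noteq> 0 \<longrightarrow> g p v v > 0)) \<and>
     (\<forall>U X Y. open U \<and> smooth_vfield \<A> U X \<and> smooth_vfield \<A> U Y \<longrightarrow>
        smooth_fun \<A> U (\<lambda>p. g p (X p) (Y p)))"

section \<open>Connections and curvature\<close>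

text \<open>A connection acts on local smooth vector fields: the usual axioms are required over every
  open set \<open>U\<close>. Locality follows, since the functions \<open>f\<close> below are arbitrary
  outside \<open>U\<close>; thus \<open>U = UNIV\<close> gives a connection on global fields, and conversely every
  such connection is local and hence extends uniquely to local fields.\<close>

type_synonym ('m, 'n) connection = "('m, 'n) vfield \<Rightarrow> ('m, 'n) vfield \<Rightarrow> ('m, 'n) vfield"

definition affine_connection ::
  "('m::topological_space, 'n::finite) chart set \<Rightarrow> ('m, 'n) connection \<Rightarrow> bool" where
  "affine_connection \<A> D \<longleftrightarrow>
     (\<forall>U X Y. open U \<and> smooth_vfield \<A> U X \<and> smooth_vfield \<A> U Y \<longrightarrow>
        smooth_vfield \<A> U (D X Y) \<and>
        (\<forall>X'. smooth_vfield \<A> U X' \<longrightarrow>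
           (\<forall>p\<in>U. D (\<lambda>q. X q + X' q) Y p = D X Y p + D X' Y p)) \<and>
        (\<forall>Y'. smooth_vfield \<A> U Y' \<longrightarrow>
           (\<forall>p\<in>U. D X (\<lambda>q. Y q + Y' q) p = D X Y p + D X Y' p)) \<and>
        (\<forall>f. smooth_fun \<A> U f \<longrightarrow>
           (\<forall>p\<in>U. D (\<lambda>q. f q *\<^sub>R X q) Y p = f p *\<^sub>R D X Y p \<and>
                  D X (\<lambda>q. f q *\<^sub>R Y q) p = act \<A> X f p *\<^sub>R Y p + f p *\<^sub>R D X Y p)))"

definition levi_civita ::
  "('m::topological_space, 'n::finite) chart set \<Rightarrow> ('m, 'n) tensor02 \<Rightarrow>
   ('m, 'n) connection \<Rightarrow> bool" where
  "levi_civita \<A> g D \<longleftrightarrow> affine_connection \<A> D \<and>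
     (\<forall>U X Y. open U \<and> smooth_vfield \<A> U X \<and> smooth_vfield \<A> U Y \<longrightarrow>
        (\<forall>p\<in>U. D X Y p - D Y X p = lie_bracket \<A> X Y p)) \<and>
     (\<forall>U X Y Z. open U \<and> smooth_vfield \<A> U X \<and> smooth_vfield \<A> U Y \<and> smooth_vfield \<A> U Z \<longrightarrow>
        (\<forall>p\<in>U. act \<A> X (\<lambda>q. g q (Y q) (Z q)) p = g p (D X Y p) (Z p) + g p (Y p) (D X Z p)))"

definition curvature ::
  "('m::topological_space, 'n::finite) chart set \<Rightarrow> ('m, 'n) connection \<Rightarrow>
   ('m, 'n) vfield \<Rightarrow> ('m, 'n) vfield \<Rightarrow> ('m, 'n) vfield \<Rightarrow> ('m, 'n) vfield" where
  "curvature \<A> D X Y Z p = D X (D Y Z) p - D Y (D X Z) p - D (lie_bracket \<A> X Y) Z p"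

definition extend_vector ::
  "('m::topological_space, 'n::finite) chart set \<Rightarrow> 'm \<Rightarrow> real ^ 'n \<Rightarrow> ('m, 'n) vfield" where
  "extend_vector \<A> p v =
     (SOME X. (\<exists>U. open U \<and> p \<in> U \<and> smooth_vfield \<A> U X) \<and> X p = v)"

text \<open>The curvature at \<open>p\<close> is tensorial, so the endomorphism of the tangent space at \<open>p\<close>
  whose trace is taken does not depend on how its argument \<open>v\<close> is extended to a local
  smooth field.\<close>

definition ricci ::
  "('m::topological_space, 'n::finite) chart set \<Rightarrow> ('m, 'n) connection \<Rightarrow>
   ('m, 'n) vfield \<Rightarrow> ('m, 'n) vfield \<Rightarrow> 'm \<Rightarrow> real" where
  "ricci \<A> D Y Z p = trace (matrix (\<lambda>v. curvature \<A> D (extend_vector \<A> p v) Y Z p))"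

section \<open>Kaehler manifolds and the quarter-symmetric connection\<close>

definition kaehler_manifold ::
  "('m::{t2_space, second_countable_topology}, 'n::finite) chart set \<Rightarrow> ('m, 'n) tensor02 \<Rightarrow>
   ('m, 'n) tensor11 \<Rightarrow> ('m, 'n) connection \<Rightarrow> bool" where
  "kaehler_manifold \<A> g A D \<longleftrightarrow>
     smooth_atlas \<A> \<and> even CARD('n) \<and> CARD('n) \<ge> 4 \<and>
     riemannian_metric \<A> g \<and> levi_civita \<A> g D \<and> tensor_field11 \<A> A \<and>
     (\<forall>p v. A p (A p v) = - v) \<and>
     (\<forall>p v w. g p (A p v) (A p w) = g p v w) \<and>
     (\<forall>U X Y. open U \<and> smooth_vfield \<A> U X \<and> smooth_vfield \<A> U Y \<longrightarrow>
        (\<forall>p\<in>U. D X (\<lambda>q. A q (Y q)) p - A p (D X Y p) = 0))"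

definition conn1 ::
  "('m, 'n::finite) connection \<Rightarrow> ('m, 'n) tensor11 \<Rightarrow> ('m, 'n) form1 \<Rightarrow> ('m, 'n) connection" where
  "conn1 D A \<pi> X Y p = D X Y p - \<pi> p (X p) *\<^sub>R A p (Y p)"

definition H1 ::
  "('m::topological_space, 'n::finite) chart set \<Rightarrow> ('m, 'n) connection \<Rightarrow>
   ('m, 'n) tensor11 \<Rightarrow> ('m, 'n) form1 \<Rightarrow>
   ('m, 'n) vfield \<Rightarrow> ('m, 'n) vfield \<Rightarrow> ('m, 'n) vfield \<Rightarrow> ('m, 'n) vfield" where
  "H1 \<A> D A \<pi> X Y Z p =
     curvature \<A> (conn1 D A \<pi>) X Y Z p +
     ricci \<A> (conn1 D A \<pi>) Y (\<lambda>q. A q (X q)) p *\<^sub>R A p (Z p)"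

end

theory Submission
  imports Defs
begin

text \<open>Since \<open>A\<close> is parallel and \<open>A\<^sup>2 = -I\<close>, the terms quadratic in the generator cancel and the
  curvature of the quarter-symmetric connection is \<open>R(X, Y)Z - d\<pi>(X, Y) AZ\<close>.  Taking the trace
  of \<open>W \<mapsto> d\<pi>(W, Y) A(AX) = - d\<pi>(W, Y) X\<close> shows that its Ricci tensor at \<open>(Y, AX)\<close> is
  \<open>Ric(Y, AX) + d\<pi>(X, Y)\<close>, so the generator drops out of \<open>H\<close>.  The trace is computed on the
  arbitrarily chosen extensions of the basis vectors, which is harmless because \<open>d\<pi>(\<cdot>, Y)\<close> is
  tensorial; this in turn rests on expanding local fields in a smooth coordinate frame.\<close>

section \<open>Calculus of \<open>C\<^sup>k\<close> maps on open sets\<close>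

lemma has_derivative_cong_open:
  assumes "open S" "x \<in> S" "\<And>y. y \<in> S \<Longrightarrow> f y = g y"
  shows "(f has_derivative F) (at x) \<longleftrightarrow> (g has_derivative F) (at x)"
  using assms has_derivative_transform_within_open[of f F x UNIV S g]
    has_derivative_transform_within_open[of g F x UNIV S f] by auto

lemma frechet_derivative_cong_open:
  assumes "open S" "x \<in> S" "\<And>y. y \<in> S \<Longrightarrow> f y = g y"
  shows "frechet_derivative f (at x) = frechet_derivative g (at x)"
  unfolding frechet_derivative_def using has_derivative_cong_open[of S x f g] assms by simp

text \<open>\<open>Ck_on\<close> takes \<open>frechet_derivative\<close> in the full space, so
  openness of \<open>S\<close> is what lets agreement on \<open>S\<close> pass to derivatives. This
  is used constantly because \<open>inv_into\<close> is controlled only on the image of a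
  chart.\<close>

lemma Ck_on_cong:
  assumes "open S" "\<And>x. x \<in> S \<Longrightarrow> f x = g x" "Ck_on k S f"
  shows "Ck_on k S g"
  using assms(2,3)
proof (induction k arbitrary: f g)
  case 0
  then show ?case by (metis Ck_on.simps(1) continuous_on_cong)
next
  case (Suc k)
  have "g differentiable_on S"
    using Suc.prems has_derivative_cong_open[OF assms(1) _ Suc.prems(1)]
    by (auto simp: differentiable_on_eq_differentiable_at[OF assms(1)] differentiable_def)
  moreover have "Ck_on k S (\<lambda>x. frechet_derivative g (at x) v)" for v
  proof (rule Suc.IH)
    show "Ck_on k S (\<lambda>x. frechet_derivative f (at x) v)" using Suc.prems by simp
    show "frechet_derivative f (at x) v = frechet_derivative g (at x) v" if "x \<in> S" for x
      using frechet_derivative_cong_open[OF assms(1) that Suc.prems(1)] by simp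
  qed
  ultimately show ?case by simp
qed

lemma Ck_on_subset: "Ck_on k S f \<Longrightarrow> T \<subseteq> S \<Longrightarrow> Ck_on k T f"
  by (induction k arbitrary: f) (auto intro: continuous_on_subset differentiable_on_subset)

lemma Ck_on_SucD: "Ck_on (Suc k) S f \<Longrightarrow> Ck_on k S f"
  by (induction k arbitrary: f) (auto intro: differentiable_imp_continuous_on)

text \<open>Lets an explicit derivative replace the chosen \<open>frechet_derivative\<close>. The
  closure properties below are inductions on \<open>k\<close> in which \<open>F\<close> comes from a
  rule of calculus.\<close>

lemma Ck_on_SucI:
  assumes "open S" "\<And>x. x \<in> S \<Longrightarrow> (f has_derivative F x) (at x)"
    and "\<And>v. Ck_on k S (\<lambda>x. F x v)"
  shows "Ck_on (Suc k) S f"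
proof -
  have "f differentiable_on S"
    using assms by (auto simp: differentiable_on_eq_differentiable_at differentiable_def)
  moreover have "Ck_on k S (\<lambda>x. frechet_derivative f (at x) v)" for v
    by (rule Ck_on_cong[OF assms(1) _ assms(3)[of v]])
      (use frechet_derivative_at[OF assms(2)] in simp)
  ultimately show ?thesis by simp
qed

lemma Ck_on_Suc_has_derivative:
  assumes "Ck_on (Suc k) S f" "open S" "x \<in> S"
  shows "(f has_derivative frechet_derivative f (at x)) (at x)"
  using assms by (simp add: differentiable_on_eq_differentiable_at frechet_derivative_works)

lemma Ck_on_const: "open S \<Longrightarrow> Ck_on k S (\<lambda>x. c)"
proof (induction k arbitrary: c)
  case (Suc k)
  then show ?case by (intro Ck_on_SucI[where F = "\<lambda>x v. 0"]) auto
qed simp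

lemma Ck_on_bounded_linear:
  assumes "open S" "bounded_linear L"
  shows "Ck_on k S f \<Longrightarrow> Ck_on k S (\<lambda>x. L (f x))"
proof (induction k arbitrary: f)
  case 0
  then show ?case by (simp add: bounded_linear.continuous_on[OF assms(2)])
next
  case (Suc k)
  show ?case
  proof (rule Ck_on_SucI[OF assms(1)])
    show "((\<lambda>x. L (f x)) has_derivative (\<lambda>v. L (frechet_derivative f (at x) v))) (at x)"
      if "x \<in> S" for x
      using bounded_linear.has_derivative[OF assms(2) Ck_on_Suc_has_derivative[OF Suc.prems assms(1) that]] .
  qed (use Suc in simp)
qed

lemma Ck_on_add:
  assumes "open S"
  shows "Ck_on k S f \<Longrightarrow> Ck_on k S g \<Longrightarrow> Ck_on k S (\<lambda>x. f x + g x)"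
proof (induction k arbitrary: f g)
  case 0
  then show ?case by (simp add: continuous_on_add)
next
  case (Suc k)
  show ?case
  proof (rule Ck_on_SucI[OF assms])
    show "((\<lambda>x. f x + g x) has_derivative
        (\<lambda>v. frechet_derivative f (at x) v + frechet_derivative g (at x) v)) (at x)"
      if "x \<in> S" for x
      using Suc.prems assms that by (intro has_derivative_add Ck_on_Suc_has_derivative)
  qed (use Suc in simp)
qed

lemma Ck_on_mult:
  fixes f g :: "'a::real_normed_vector \<Rightarrow> real"
  assumes "open S"
  shows "Ck_on k S f \<Longrightarrow> Ck_on k S g \<Longrightarrow> Ck_on k S (\<lambda>x. f x * g x)"
proof (induction k arbitrary: f g)
  case 0
  then show ?case by (simp add: continuous_on_mult)
next
  case (Suc k)
  show ?case
  proof (rule Ck_on_SucI[OF assms])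
    show "((\<lambda>x. f x * g x) has_derivative
        (\<lambda>v. f x * frechet_derivative g (at x) v + frechet_derivative f (at x) v * g x)) (at x)"
      if "x \<in> S" for x
      using Suc.prems assms that by (intro has_derivative_mult Ck_on_Suc_has_derivative)
    show "Ck_on k S (\<lambda>x. f x * frechet_derivative g (at x) v + frechet_derivative f (at x) v * g x)"
      for v
      using Ck_on_SucD[OF Suc.prems(1)] Ck_on_SucD[OF Suc.prems(2)] Suc.prems
      by (intro Ck_on_add[OF assms] Suc.IH) auto
  qed
qed

lemma Ck_on_sum:
  assumes "open S" "finite I" "\<And>i. i \<in> I \<Longrightarrow> Ck_on k S (f i)"
  shows "Ck_on k S (\<lambda>x. \<Sum>i\<in>I. f i x)"
  using assms(2,3)
  by (induction I rule: finite_induct) (auto intro: Ck_on_add Ck_on_const assms(1))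

text \<open>Expanding the inner derivative in an orthonormal basis turns the chain rule into a
  finite sum of products of real functions: components of the derivative of \<open>h\<close>, and
  partial derivatives of \<open>f\<close> composed with \<open>h\<close>. The latter are covered by
  the induction hypothesis, which generalises \<open>f\<close> and keeps \<open>h\<close>
  fixed.\<close>

lemma Ck_on_compose:
  fixes f :: "'b::euclidean_space \<Rightarrow> real" and h :: "'a::real_normed_vector \<Rightarrow> 'b"
  assumes "open S" "open T" "h ` S \<subseteq> T"
  shows "Ck_on k T f \<Longrightarrow> Ck_on k S h \<Longrightarrow> Ck_on k S (f \<circ> h)"
proof (induction k arbitrary: f)
  case 0
  then show ?case
    using continuous_on_compose[of S h f] continuous_on_subset[OF _ assms(3), of f] by simp
next
  case (Suc k)
  let ?F = "\<lambda>x v. \<Sum>b\<in>Basis. (frechet_derivative h (at x) v \<bullet> b) * frechet_derivative f (at (h x)) b"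
  show ?case
  proof (rule Ck_on_SucI[OF assms(1)])
    fix x assume x: "x \<in> S"
    have h: "(h has_derivative frechet_derivative h (at x)) (at x)"
      using Suc.prems x assms Ck_on_Suc_has_derivative by blast
    have f: "(f has_derivative frechet_derivative f (at (h x))) (at (h x))"
      using Suc.prems x assms Ck_on_Suc_has_derivative by blast
    have expand: "frechet_derivative f (at (h x)) w = (\<Sum>b\<in>Basis. (w \<bullet> b) * frechet_derivative f (at (h x)) b)"
      for w
      using linear_sum[OF has_derivative_linear[OF f], of "\<lambda>b. (w \<bullet> b) *\<^sub>R b" Basis]
      by (simp add: euclidean_representation linear_scale[OF has_derivative_linear[OF f]])
    have "?F x = frechet_derivative f (at (h x)) \<circ> frechet_derivative h (at x)"
      unfolding comp_def by (rule ext) (rule expand[symmetric])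
    then show "((f \<circ> h) has_derivative ?F x) (at x)"
      using diff_chain_at[OF h f] by simp
  next
    fix v
    have "Ck_on k S ((\<lambda>y. frechet_derivative f (at y) b) \<circ> h)" for b
      using Ck_on_SucD[OF Suc.prems(2)] Suc.prems by (intro Suc.IH) auto
    then have "Ck_on k S (\<lambda>x. frechet_derivative f (at (h x)) b)" for b
      by (simp add: comp_def)
    moreover have "Ck_on k S (\<lambda>x. frechet_derivative h (at x) v \<bullet> b)" for b
      by (rule Ck_on_bounded_linear[OF assms(1) bounded_linear_inner_left]) (use Suc.prems in simp)
    ultimately show "Ck_on k S (\<lambda>x. ?F x v)"
      by (intro Ck_on_sum[OF assms(1)] Ck_on_mult[OF assms(1)] finite_Basis)
  qed
qed

lemma Cinf_on_cong:
  "open S \<Longrightarrow> (\<And>x. x \<in> S \<Longrightarrow> f x = g x) \<Longrightarrow> Cinf_on S f \<Longrightarrow> Cinf_on S g"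
  unfolding Cinf_on_def using Ck_on_cong by blast

lemma Cinf_on_subset: "Cinf_on S f \<Longrightarrow> T \<subseteq> S \<Longrightarrow> Cinf_on T f"
  unfolding Cinf_on_def using Ck_on_subset by blast

lemma Cinf_on_frechet_derivative:
  "Cinf_on S f \<Longrightarrow> Cinf_on S (\<lambda>x. frechet_derivative f (at x) v)"
  unfolding Cinf_on_def by (metis Ck_on.simps(2))

lemma Cinf_on_differentiable:
  "Cinf_on S f \<Longrightarrow> open S \<Longrightarrow> x \<in> S \<Longrightarrow> f differentiable (at x)"
  unfolding Cinf_on_def by (metis Ck_on.simps(2) differentiable_on_eq_differentiable_at)

lemma Cinf_on_compose:
  fixes f :: "'b::euclidean_space \<Rightarrow> real"
  assumes "open S" "open T" "h ` S \<subseteq> T" "Cinf_on T f" "Cinf_on S h"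
  shows "Cinf_on S (f \<circ> h)"
  using assms Ck_on_compose unfolding Cinf_on_def by blast

section \<open>Smooth functions and vector fields in charts\<close>

lemma smooth_fun_subset: "smooth_fun \<A> U f \<Longrightarrow> V \<subseteq> U \<Longrightarrow> smooth_fun \<A> V f"
  unfolding smooth_fun_def by (force intro: Cinf_on_subset)

lemma smooth_vfield_subset: "smooth_vfield \<A> U X \<Longrightarrow> V \<subseteq> U \<Longrightarrow> smooth_vfield \<A> V X"
  unfolding smooth_vfield_def by blast

section \<open>Charts and their transition maps\<close>

locale smooth_manifold =
  fixes \<A> :: "('m::{t2_space, second_countable_topology}, 'n::finite) chart set"
  assumes atlas: "smooth_atlas \<A>"
begin

lemma open_chart: "(U, \<phi>) \<in> \<A> \<Longrightarrow> open U"
  using atlas unfolding smooth_atlas_def by blast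

lemma chart_homeomorphism: "(U, \<phi>) \<in> \<A> \<Longrightarrow> homeomorphism U (\<phi> ` U) \<phi> (inv_into U \<phi>)"
  using atlas unfolding smooth_atlas_def by blast

lemma inv_chart: "(U, \<phi>) \<in> \<A> \<Longrightarrow> q \<in> U \<Longrightarrow> inv_into U \<phi> (\<phi> q) = q"
  by (rule homeomorphism_apply1[OF chart_homeomorphism])

lemma open_chart_image:
  assumes "(U, \<phi>) \<in> \<A>" "open V"
  shows "open (\<phi> ` (V \<inter> U))"
proof -
  have "openin (top_of_set (\<phi> ` U)) (\<phi> ` (V \<inter> U))"
    using homeomorphism_imp_open_map[OF chart_homeomorphism[OF assms(1)], of "V \<inter> U"] assms(2)
    by (metis Int_commute openin_open_Int)
  moreover have "open (\<phi> ` U)"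
    using atlas assms(1) unfolding smooth_atlas_def by blast
  ultimately show ?thesis using openin_open_trans by blast
qed

lemma transition:
  "(U, \<phi>) \<in> \<A> \<Longrightarrow> (V, \<psi>) \<in> \<A> \<Longrightarrow> Cinf_on (\<phi> ` (U \<inter> V)) (\<psi> \<circ> inv_into U \<phi>)"
  using atlas unfolding smooth_atlas_def by blast

lemma transition_differentiable:
  assumes "(U, \<phi>) \<in> \<A>" "(V, \<psi>) \<in> \<A>" "q \<in> U" "q \<in> V"
  shows "(\<psi> \<circ> inv_into U \<phi>) differentiable (at (\<phi> q))"
  using Cinf_on_differentiable[OF transition[OF assms(1,2)]]
    open_chart_image[OF assms(1) open_chart[OF assms(2)]] assms(3,4)
  by (simp add: Int_commute)

lemma chart_at:
  assumes "chart_at \<A> p = (U, \<phi>)"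
  shows "(U, \<phi>) \<in> \<A>" "p \<in> U"
proof -
  have "(\<Union>(U, \<phi>)\<in>\<A>. U) = UNIV"
    using atlas unfolding smooth_atlas_def by blast
  then have "(\<Union>c\<in>\<A>. fst c) = UNIV"
    by (simp add: case_prod_unfold)
  then have "\<exists>c. c \<in> \<A> \<and> p \<in> fst c"
    by blast
  then have "chart_at \<A> p \<in> \<A> \<and> p \<in> fst (chart_at \<A> p)"
    unfolding chart_at_def by (rule someI_ex)
  then show "(U, \<phi>) \<in> \<A>" "p \<in> U" using assms by auto
qed

text \<open>The chain rule through the transition map, valid because both expressions of
  \<open>f\<close> agree on the open image of the overlap. The codomain is general so that
  \<open>f\<close> may be a real function or, in the frame expansion, a chart map.\<close>

lemma frechet_derivative_change_chart:
  fixes f :: "'m \<Rightarrow> 'b::real_normed_vector"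
  assumes "(U, \<phi>) \<in> \<A>" "(V, \<psi>) \<in> \<A>" "q \<in> U" "q \<in> V"
    and "(f \<circ> inv_into V \<psi>) differentiable (at (\<psi> q))"
  shows "frechet_derivative (f \<circ> inv_into U \<phi>) (at (\<phi> q)) v =
    frechet_derivative (f \<circ> inv_into V \<psi>) (at (\<psi> q))
      (frechet_derivative (\<psi> \<circ> inv_into U \<phi>) (at (\<phi> q)) v)"
proof -
  have q: "(\<psi> \<circ> inv_into U \<phi>) (\<phi> q) = \<psi> q"
    using assms inv_chart by simp
  have "frechet_derivative (f \<circ> inv_into U \<phi>) (at (\<phi> q)) =
    frechet_derivative ((f \<circ> inv_into V \<psi>) \<circ> (\<psi> \<circ> inv_into U \<phi>)) (at (\<phi> q))"
  proof (rule frechet_derivative_cong_open)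
    show "open (\<phi> ` (V \<inter> U))" using open_chart_image assms open_chart by blast
  qed (use assms inv_chart in auto)
  also have "\<dots> = frechet_derivative (f \<circ> inv_into V \<psi>) (at (\<psi> q)) \<circ>
      frechet_derivative (\<psi> \<circ> inv_into U \<phi>) (at (\<phi> q))"
    using frechet_derivative_compose[of "\<psi> \<circ> inv_into U \<phi>" "\<phi> q" "f \<circ> inv_into V \<psi>"]
      transition_differentiable[OF assms(1-4)] assms(5) q by simp
  finally show ?thesis by simp
qed

lemma frechet_derivative_chart_inverse:
  assumes "(U, \<phi>) \<in> \<A>" "q \<in> U"
  shows "frechet_derivative (\<phi> \<circ> inv_into U \<phi>) (at (\<phi> q)) v = v"
proof -
  have "frechet_derivative (\<phi> \<circ> inv_into U \<phi>) (at (\<phi> q)) = frechet_derivative (\<lambda>x. x) (at (\<phi> q))"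
    by (rule frechet_derivative_cong_open[OF open_chart_image[OF assms(1) open_chart[OF assms(1)]]])
      (use assms inv_chart in auto)
  then show ?thesis by simp
qed

section \<open>Algebra of smooth functions\<close>

lemma smooth_fun_cong:
  assumes "open U" "\<And>q. q \<in> U \<Longrightarrow> f q = g q" "smooth_fun \<A> U f"
  shows "smooth_fun \<A> U g"
  unfolding smooth_fun_def
proof clarify
  fix V \<phi> assume V: "(V, \<phi>) \<in> \<A>"
  show "Cinf_on (\<phi> ` (U \<inter> V)) (g \<circ> inv_into V \<phi>)"
    by (rule Cinf_on_cong[of _ "f \<circ> inv_into V \<phi>"])
      (use V assms open_chart_image inv_chart in \<open>auto simp: smooth_fun_def\<close>)
qed

lemma smooth_fun_const: "open U \<Longrightarrow> smooth_fun \<A> U (\<lambda>q. c)"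
  unfolding smooth_fun_def by (auto simp: Cinf_on_def comp_def intro!: Ck_on_const open_chart_image)

lemma smooth_fun_add:
  assumes "open U" "smooth_fun \<A> U f" "smooth_fun \<A> U g"
  shows "smooth_fun \<A> U (\<lambda>q. f q + g q)"
  using assms unfolding smooth_fun_def
  by (auto simp: Cinf_on_def comp_def intro!: Ck_on_add open_chart_image)

lemma smooth_fun_mult:
  assumes "open U" "smooth_fun \<A> U f" "smooth_fun \<A> U g"
  shows "smooth_fun \<A> U (\<lambda>q. f q * g q)"
  using assms unfolding smooth_fun_def
  by (auto simp: Cinf_on_def comp_def intro!: Ck_on_mult open_chart_image)

lemma smooth_fun_differentiable:
  assumes "open V" "q \<in> V" "smooth_fun \<A> V f" "(U, \<phi>) \<in> \<A>" "q \<in> U"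
  shows "(f \<circ> inv_into U \<phi>) differentiable (at (\<phi> q))"
  by (rule Cinf_on_differentiable[of "\<phi> ` (V \<inter> U)"])
    (use assms open_chart_image in \<open>auto simp: smooth_fun_def\<close>)

text \<open>Coordinate functions are the test functions that extract smooth components from a smooth
  vector field; their smoothness is that of the transition maps.\<close>

lemma smooth_fun_chart_component:
  assumes "(U, \<phi>) \<in> \<A>"
  shows "smooth_fun \<A> U (\<lambda>q. \<phi> q $ i)"
  unfolding smooth_fun_def
proof clarify
  fix V \<psi> assume V: "(V, \<psi>) \<in> \<A>"
  have "open (\<psi> ` (U \<inter> V))" using open_chart_image[OF V open_chart[OF assms]] .
  moreover have "Ck_on k (\<psi> ` (U \<inter> V)) (\<phi> \<circ> inv_into V \<psi>)" for k
    using transition[OF V assms] by (simp add: Cinf_on_def Int_commute)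
  ultimately have "Ck_on k (\<psi> ` (U \<inter> V)) (\<lambda>x. (\<phi> \<circ> inv_into V \<psi>) x $ i)" for k
    by (rule Ck_on_bounded_linear[OF _ bounded_linear_vec_nth])
  then show "Cinf_on (\<psi> ` (U \<inter> V)) ((\<lambda>q. \<phi> q $ i) \<circ> inv_into V \<psi>)"
    by (simp add: Cinf_on_def comp_def)
qed

section \<open>Tangent vectors as derivations\<close>

lemma has_derivative_dir_deriv:
  assumes "open U" "p \<in> U" "smooth_fun \<A> U f" "chart_at \<A> p = (V, \<phi>)"
  shows "((\<lambda>x. f (inv_into V \<phi> x)) has_derivative (\<lambda>v. dir_deriv \<A> p v f)) (at (\<phi> p))"
  using smooth_fun_differentiable[OF assms(1-3) chart_at[OF assms(4)]] assms(4)
  by (simp add: dir_deriv_def comp_def frechet_derivative_works)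

lemma dir_deriv_eqI:
  assumes "((\<lambda>x. f (inv_into V \<phi> x)) has_derivative F) (at (\<phi> p))" "chart_at \<A> p = (V, \<phi>)"
  shows "dir_deriv \<A> p v f = F v"
  using frechet_derivative_at[OF assms(1)] assms(2) by (simp add: dir_deriv_def comp_def)

lemma linear_dir_deriv:
  assumes "open U" "p \<in> U" "smooth_fun \<A> U f"
  shows "linear (\<lambda>v. dir_deriv \<A> p v f)"
  using has_derivative_dir_deriv[OF assms] has_derivative_linear by (metis surj_pair)

lemma dir_deriv_add:
  assumes "open U" "p \<in> U" "smooth_fun \<A> U f" "smooth_fun \<A> U h"
  shows "dir_deriv \<A> p v (\<lambda>q. f q + h q) = dir_deriv \<A> p v f + dir_deriv \<A> p v h"
proof -
  obtain V \<phi> where c: "chart_at \<A> p = (V, \<phi>)" by (cases "chart_at \<A> p")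
  show ?thesis
    by (rule dir_deriv_eqI[OF has_derivative_add[OF has_derivative_dir_deriv[OF assms(1-3) c]
            has_derivative_dir_deriv[OF assms(1,2,4) c]] c])
qed

lemma dir_deriv_mult:
  assumes "open U" "p \<in> U" "smooth_fun \<A> U f" "smooth_fun \<A> U h"
  shows "dir_deriv \<A> p v (\<lambda>q. f q * h q) = f p * dir_deriv \<A> p v h + dir_deriv \<A> p v f * h p"
proof -
  obtain V \<phi> where c: "chart_at \<A> p = (V, \<phi>)" by (cases "chart_at \<A> p")
  show ?thesis
    using dir_deriv_eqI[OF has_derivative_mult[OF has_derivative_dir_deriv[OF assms(1-3) c]
            has_derivative_dir_deriv[OF assms(1,2,4) c]] c]
    by (simp add: inv_chart[OF chart_at[OF c]])
qed

lemma act_add_left: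
  assumes "open U" "p \<in> U" "smooth_fun \<A> U f"
  shows "act \<A> (\<lambda>q. X q + Y q) f p = act \<A> X f p + act \<A> Y f p"
  using linear_add[OF linear_dir_deriv[OF assms]] by (simp add: act_def)

lemma act_scaleR_left:
  assumes "open U" "p \<in> U" "smooth_fun \<A> U f"
  shows "act \<A> (\<lambda>q. c q *\<^sub>R X q) f p = c p * act \<A> X f p"
  using linear_scale[OF linear_dir_deriv[OF assms]] by (simp add: act_def)

lemma smooth_vfield_add:
  assumes "smooth_vfield \<A> U X" "smooth_vfield \<A> U Y"
  shows "smooth_vfield \<A> U (\<lambda>q. X q + Y q)"
  unfolding smooth_vfield_def
proof clarify
  fix V f assume V: "open V" "V \<subseteq> U" "smooth_fun \<A> V f"
  show "smooth_fun \<A> V (act \<A> (\<lambda>q. X q + Y q) f)"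
    by (rule smooth_fun_cong[OF V(1) act_add_left[OF V(1) _ V(3), symmetric] smooth_fun_add])
      (use assms V in \<open>auto simp: smooth_vfield_def\<close>)
qed

lemma smooth_vfield_scaleR:
  assumes "smooth_fun \<A> U c" "smooth_vfield \<A> U X"
  shows "smooth_vfield \<A> U (\<lambda>q. c q *\<^sub>R X q)"
  unfolding smooth_vfield_def
proof clarify
  fix V f assume V: "open V" "V \<subseteq> U" "smooth_fun \<A> V f"
  show "smooth_fun \<A> V (act \<A> (\<lambda>q. c q *\<^sub>R X q) f)"
    by (rule smooth_fun_cong[OF V(1) act_scaleR_left[OF V(1) _ V(3), symmetric] smooth_fun_mult])
      (use assms V in \<open>auto simp: smooth_vfield_def intro: smooth_fun_subset\<close>)
qed

section \<open>Coordinate vector fields and tensoriality\<close>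

text \<open>The field with constant components \<open>v\<close> in the chart \<open>\<phi>\<close>, re-expressed at each \<open>q\<close> in the
  chart that identifies the tangent space at \<open>q\<close>.  Its value outside the chart domain only serves
  to make the frame expansion below an equality of functions on the whole manifold.\<close>

definition coord_field :: "('m, 'n) chart \<Rightarrow> real ^ 'n \<Rightarrow> ('m, 'n) vfield" where
  "coord_field c v q =
     (if q \<in> fst c
      then frechet_derivative (snd (chart_at \<A> q) \<circ> inv_into (fst c) (snd c)) (at (snd c q)) v
      else v)"

text \<open>The Jacobian built into \<open>coord_field\<close> absorbs the change from \<phi> to the
  chart chosen at \<open>q\<close>. What remains is a derivative in the single chart \<phi>, so
  jumps of \<open>chart_at\<close> do no harm.\<close>

lemma act_coord_field:
  assumes "(U, \<phi>) \<in> \<A>" "open V" "q \<in> V" "q \<in> U" "smooth_fun \<A> V f"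
  shows "act \<A> (coord_field (U, \<phi>) v) f q = frechet_derivative (f \<circ> inv_into U \<phi>) (at (\<phi> q)) v"
proof -
  obtain W \<psi> where c: "chart_at \<A> q = (W, \<psi>)" by (cases "chart_at \<A> q")
  note W = chart_at[OF c]
  show ?thesis
    using frechet_derivative_change_chart[OF assms(1) W(1) assms(4) W(2)
        smooth_fun_differentiable[OF assms(2,3,5) W]] c assms(4)
    by (simp add: act_def dir_deriv_def coord_field_def)
qed

lemma smooth_vfield_coord_field:
  assumes "(U, \<phi>) \<in> \<A>"
  shows "smooth_vfield \<A> U (coord_field (U, \<phi>) v)"
  unfolding smooth_vfield_def
proof clarify
  fix V f assume V: "open V" "V \<subseteq> U" "smooth_fun \<A> V f"
  show "smooth_fun \<A> V (act \<A> (coord_field (U, \<phi>) v) f)"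
    unfolding smooth_fun_def
  proof clarify
    fix W \<eta> assume W: "(W, \<eta>) \<in> \<A>"
    let ?d = "\<lambda>x. frechet_derivative (f \<circ> inv_into U \<phi>) (at x) v"
    have o: "open (\<eta> ` (V \<inter> W))" by (rule open_chart_image[OF W V(1)])
    \<comment> \<open>Seen from the chart \<eta>, the action is a directional derivative taken in
      \<phi>, precomposed with the transition map.\<close>
    have "Cinf_on (\<eta> ` (V \<inter> W)) (?d \<circ> (\<phi> \<circ> inv_into W \<eta>))"
    proof (rule Cinf_on_compose[OF o open_chart_image[OF assms V(1)]])
      show "(\<phi> \<circ> inv_into W \<eta>) ` \<eta> ` (V \<inter> W) \<subseteq> \<phi> ` (V \<inter> U)"
        using V(2) inv_chart[OF W] by auto
      show "Cinf_on (\<phi> ` (V \<inter> U)) ?d"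
        using V(3) assms by (auto simp: smooth_fun_def intro!: Cinf_on_frechet_derivative)
      show "Cinf_on (\<eta> ` (V \<inter> W)) (\<phi> \<circ> inv_into W \<eta>)"
        by (rule Cinf_on_subset[OF transition[OF W assms]]) (use V(2) in auto)
    qed
    then show "Cinf_on (\<eta> ` (V \<inter> W)) (act \<A> (coord_field (U, \<phi>) v) f \<circ> inv_into W \<eta>)"
    proof (rule Cinf_on_cong[OF o, rotated])
      fix x assume "x \<in> \<eta> ` (V \<inter> W)"
      then show "(?d \<circ> (\<phi> \<circ> inv_into W \<eta>)) x = (act \<A> (coord_field (U, \<phi>) v) f \<circ> inv_into W \<eta>) x"
        using V act_coord_field[OF assms V(1) _ _ V(3)] inv_chart[OF W] by auto
    qed
  qed
qed

lemma coord_field_base: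
  assumes "chart_at \<A> p = (U, \<phi>)"
  shows "coord_field (U, \<phi>) v p = v"
  using chart_at[OF assms] assms frechet_derivative_chart_inverse by (simp add: coord_field_def)

text \<open>A coordinate field of the chart chosen at \<open>p\<close> witnesses existence, which
  makes the choice in \<open>extend_vector\<close> meaningful. Nothing beyond smoothness near
  \<open>p\<close> and the value at \<open>p\<close> is known of the chosen field.\<close>

lemma extend_vector:
  obtains U where "open U" "p \<in> U" "smooth_vfield \<A> U (extend_vector \<A> p v)"
    and "extend_vector \<A> p v p = v"
proof -
  obtain U \<phi> where c: "chart_at \<A> p = (U, \<phi>)" by (cases "chart_at \<A> p")
  have "\<exists>X. (\<exists>U. open U \<and> p \<in> U \<and> smooth_vfield \<A> U X) \<and> X p = v"
    using smooth_vfield_coord_field[OF chart_at(1)[OF c]] coord_field_base[OF c]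
      open_chart[OF chart_at(1)[OF c]] chart_at(2)[OF c] by meson
  from someI_ex[OF this] show ?thesis
    unfolding extend_vector_def[symmetric] using that by blast
qed

text \<open>The coefficients are the actions of \<open>X\<close> on the coordinate functions. The
  last conclusion equates whole functions, so that it can be substituted into a functional of vector
  fields without first proving that functional local.\<close>

lemma coord_field_expansion:
  assumes p: "chart_at \<A> p = (U, \<phi>)" and X: "smooth_vfield \<A> V X" "open V" "V \<subseteq> U"
  obtains c where "\<And>i. smooth_fun \<A> V (c i)" "\<And>i. c i p = X p $ i"
    and "X = (\<lambda>q. \<Sum>i\<in>UNIV. c i q *\<^sub>R coord_field (U, \<phi>) (axis i 1) q)"
proof -
  note U = chart_at[OF p]
  \<comment> \<open>Off \<open>U\<close> the coordinate fields are the standard basis by definition,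
    so the raw components of \<open>X\<close> are the matching coefficients there.\<close>
  define c where "c i q = (if q \<in> U then act \<A> X (\<lambda>q. \<phi> q $ i) q else X q $ i)" for i q
  have act_X: "act \<A> X (\<lambda>q. \<phi> q $ i) q =
      frechet_derivative (\<phi> \<circ> inv_into W \<psi>) (at (\<psi> q)) (X q) $ i"
    if "q \<in> U" "chart_at \<A> q = (W, \<psi>)" for q i W \<psi>
  proof -
    have "((\<phi> \<circ> inv_into W \<psi>) has_derivative frechet_derivative (\<phi> \<circ> inv_into W \<psi>) (at (\<psi> q)))
        (at (\<psi> q))"
      using transition_differentiable[OF chart_at(1)[OF that(2)] U(1) chart_at(2)[OF that(2)] that(1)]
      by (simp add: frechet_derivative_works)
    from bounded_linear.has_derivative[OF bounded_linear_vec_nth this, of i]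
    have "((\<lambda>x. \<phi> (inv_into W \<psi> x) $ i) has_derivative
        (\<lambda>v. frechet_derivative (\<phi> \<circ> inv_into W \<psi>) (at (\<psi> q)) v $ i)) (at (\<psi> q))"
      by (simp only: comp_def)
    from dir_deriv_eqI[OF this that(2)] show ?thesis
      by (simp only: act_def)
  qed
  show thesis
  proof
    fix i
    show "smooth_fun \<A> V (c i)"
      by (rule smooth_fun_cong[of _ "act \<A> X (\<lambda>q. \<phi> q $ i)"])
        (use X smooth_fun_subset[OF smooth_fun_chart_component[OF U(1)] X(3)] in
          \<open>auto simp: c_def smooth_vfield_def\<close>)
    show "c i p = X p $ i"
      using act_X[OF U(2) p] frechet_derivative_chart_inverse[OF U] U(2) by (simp add: c_def)
  next
    have "X q = (\<Sum>i\<in>UNIV. c i q *\<^sub>R coord_field (U, \<phi>) (axis i 1) q)" for q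
    proof (cases "q \<in> U")
      case True
      obtain W \<psi> where q: "chart_at \<A> q = (W, \<psi>)" by (cases "chart_at \<A> q")
      note W = chart_at[OF q]
      define J where "J = frechet_derivative (\<psi> \<circ> inv_into U \<phi>) (at (\<phi> q))"
      define K where "K = frechet_derivative (\<phi> \<circ> inv_into W \<psi>) (at (\<psi> q))"
      have J: "linear J"
        unfolding J_def by (rule linear_frechet_derivative[OF transition_differentiable[OF U(1) W(1) True W(2)]])
      \<comment> \<open>\<open>J\<close> and \<open>K\<close> are the Jacobians of mutually inverse
        transition maps: the change of chart is applied to the chart map \<psi> itself.\<close>
      have "X q = J (K (X q))"
        using frechet_derivative_change_chart[OF W(1) U(1) W(2) True, of \<psi> "X q"]
          transition_differentiable[OF U(1) W(1) True W(2)] frechet_derivative_chart_inverse[OF W]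
        by (simp add: J_def K_def)
      also have "\<dots> = J (\<Sum>i\<in>UNIV. (K (X q) $ i) *\<^sub>R axis i 1)"
        using basis_expansion[of "K (X q)"] by (simp add: scalar_mult_eq_scaleR)
      also have "\<dots> = (\<Sum>i\<in>UNIV. (K (X q) $ i) *\<^sub>R J (axis i 1))"
        by (simp add: linear_sum[OF J] linear_scale[OF J])
      finally show ?thesis
        using True q by (simp add: c_def act_X[OF True q] coord_field_def J_def K_def)
    next
      case False
      then show ?thesis
        using basis_expansion[of "X q"] by (simp add: c_def coord_field_def scalar_mult_eq_scaleR)
    qed
    then show "X = (\<lambda>q. \<Sum>i\<in>UNIV. c i q *\<^sub>R coord_field (U, \<phi>) (axis i 1) q)" by blast
  qed
qed

text \<open>Function-linearity forces dependence on \<open>X p\<close> alone: \<open>X\<close> and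
  the chosen extensions of the basis vectors are all expanded in one coordinate frame around
  \<open>p\<close>. The hypotheses range over smaller \<open>V\<close> because these expansions
  exist only after shrinking the domain.\<close>

lemma tensorial_expansion:
  fixes T :: "('m, 'n) vfield \<Rightarrow> real"
  assumes add: "\<And>V X Y. open V \<Longrightarrow> p \<in> V \<Longrightarrow> V \<subseteq> U \<Longrightarrow> smooth_vfield \<A> V X \<Longrightarrow>
      smooth_vfield \<A> V Y \<Longrightarrow> T (\<lambda>q. X q + Y q) = T X + T Y"
    and scale: "\<And>V X f. open V \<Longrightarrow> p \<in> V \<Longrightarrow> V \<subseteq> U \<Longrightarrow> smooth_vfield \<A> V X \<Longrightarrow>
      smooth_fun \<A> V f \<Longrightarrow> T (\<lambda>q. f q *\<^sub>R X q) = f p * T X"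
    and U: "open U" "p \<in> U" and X: "smooth_vfield \<A> U X"
  shows "T X = (\<Sum>i\<in>UNIV. X p $ i * T (extend_vector \<A> p (axis i 1)))"
proof -
  obtain C \<phi> where p: "chart_at \<A> p = (C, \<phi>)" by (cases "chart_at \<A> p")
  note C = chart_at[OF p]
  let ?E = "\<lambda>i. coord_field (C, \<phi>) (axis i 1)"
  \<comment> \<open>Smoothness of the partial sums is carried through the induction because
    \<open>add\<close> asks for it.\<close>
  have sum: "T (\<lambda>q. \<Sum>i\<in>I. c i q *\<^sub>R ?E i q) = (\<Sum>i\<in>I. c i p * T (?E i)) \<and>
      smooth_vfield \<A> V (\<lambda>q. \<Sum>i\<in>I. c i q *\<^sub>R ?E i q)"
    if V: "open V" "p \<in> V" "V \<subseteq> U \<inter> C" and c: "\<And>i. smooth_fun \<A> V (c i)" for V c and I :: "'n set"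
  proof -
    have E: "smooth_vfield \<A> V (?E i)" for i
      using smooth_vfield_subset[OF smooth_vfield_coord_field[OF C(1)]] V(3) by blast
    have "finite I" by simp
    then show ?thesis
    proof (induction I rule: finite_induct)
      case empty
      \<comment> \<open>The zero field is a frame field scaled by the zero function, so
        \<open>scale\<close> yields that \<open>T\<close> vanishes on it.\<close>
      have z: "smooth_fun \<A> V (\<lambda>q. 0)" by (rule smooth_fun_const[OF V(1)])
      show ?case
        using scale[OF V(1,2) _ E z] smooth_vfield_scaleR[OF z E] V(3) by simp
    next
      case (insert j I)
      have s: "smooth_vfield \<A> V (\<lambda>q. c j q *\<^sub>R ?E j q)" by (rule smooth_vfield_scaleR[OF c E])
      show ?case
        using insert add[OF V(1,2) _ s] smooth_vfield_add[OF s] scale[OF V(1,2) _ E c] V(3) by simp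
    qed
  qed
  \<comment> \<open>\<open>V\<close> need not lie in \<open>U\<close>: each field from
    \<open>extend_vector\<close> comes with its own neighbourhood, which is then intersected with
    \<open>U\<close> and the chart domain.\<close>
  have frame: "T Y = (\<Sum>i\<in>UNIV. Y p $ i * T (?E i))"
    if V: "open V" "p \<in> V" and Y: "smooth_vfield \<A> V Y" for V Y
  proof -
    let ?V = "V \<inter> (U \<inter> C)"
    have o: "open ?V" using V U open_chart[OF C(1)] by blast
    obtain c where c: "\<And>i. smooth_fun \<A> ?V (c i)" "\<And>i. c i p = Y p $ i"
      "Y = (\<lambda>q. \<Sum>i\<in>UNIV. c i q *\<^sub>R ?E i q)"
      using coord_field_expansion[OF p smooth_vfield_subset[OF Y, of ?V] o] by auto
    have "T (\<lambda>q. \<Sum>i\<in>UNIV. c i q *\<^sub>R ?E i q) = (\<Sum>i\<in>UNIV. c i p * T (?E i))"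
      using sum[where c = c and I = UNIV, OF o _ _ c(1)] V U C by blast
    then show ?thesis unfolding c(3)[symmetric] c(2) .
  qed
  \<comment> \<open>The two fields may differ away from \<open>p\<close>, but the components of the
    extension at \<open>p\<close> are those of a basis vector, so its expansion collapses to one
    term.\<close>
  have "T (extend_vector \<A> p (axis j 1)) = T (?E j)" for j
  proof -
    obtain V where V: "open V" "p \<in> V" "smooth_vfield \<A> V (extend_vector \<A> p (axis j 1))"
      "extend_vector \<A> p (axis j 1) p = axis j (1::real)"
      by (rule extend_vector)
    have "axis j (1::real) $ i * T (?E i) = (if i = j then T (?E i) else 0)" for i
      by (simp add: axis_def)
    then show ?thesis
      using frame[OF V(1-3)] unfolding V(4) by simp
  qed
  then show ?thesis using frame[OF U X] by simp
qed

end

section \<open>The curvature of the quarter-symmetric connection\<close>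

text \<open>The exterior derivative of \<pi> in its invariant form. For a torsion-free connection
  \<nabla> it equals (\<nabla>_X \<pi>)(Y) - (\<nabla>_Y \<pi>)(X), the coefficient by which the
  generator enters the curvature of the first kind.\<close>

definition ext_deriv ::
  "('m::topological_space, 'n::finite) chart set \<Rightarrow> ('m, 'n) form1 \<Rightarrow>
   ('m, 'n) vfield \<Rightarrow> ('m, 'n) vfield \<Rightarrow> 'm \<Rightarrow> real" where
  "ext_deriv \<A> \<pi> X Y p = act \<A> X (\<lambda>q. \<pi> q (Y q)) p - act \<A> Y (\<lambda>q. \<pi> q (X q)) p -
     \<pi> p (lie_bracket \<A> X Y p)"

lemma affine_connectionD:
  assumes "affine_connection \<A> D" "open U" "smooth_vfield \<A> U X" "smooth_vfield \<A> U Y"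
  shows "smooth_vfield \<A> U (D X Y)"
    and "smooth_vfield \<A> U X' \<Longrightarrow> p \<in> U \<Longrightarrow> D (\<lambda>q. X q + X' q) Y p = D X Y p + D X' Y p"
    and "smooth_vfield \<A> U Y' \<Longrightarrow> p \<in> U \<Longrightarrow> D X (\<lambda>q. Y q + Y' q) p = D X Y p + D X Y' p"
    and "smooth_fun \<A> U f \<Longrightarrow> p \<in> U \<Longrightarrow> D (\<lambda>q. f q *\<^sub>R X q) Y p = f p *\<^sub>R D X Y p"
    and "smooth_fun \<A> U f \<Longrightarrow> p \<in> U \<Longrightarrow>
      D X (\<lambda>q. f q *\<^sub>R Y q) p = act \<A> X f p *\<^sub>R Y p + f p *\<^sub>R D X Y p"
  using assms unfolding affine_connection_def by blast+

section \<open>Kaehler manifolds and their parallel complex structure\<close>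

locale kaehler =
  fixes \<A> :: "('m::{t2_space, second_countable_topology}, 'n::finite) chart set"
    and g :: "('m, 'n) tensor02" and A :: "('m, 'n) tensor11" and D :: "('m, 'n) connection"
  assumes kaehler: "kaehler_manifold \<A> g A D"
begin

sublocale smooth_manifold \<A>
  using kaehler by unfold_locales (simp add: kaehler_manifold_def)

lemma connection: "affine_connection \<A> D"
  using kaehler by (simp add: kaehler_manifold_def levi_civita_def)

lemma torsion_free:
  assumes "open U" "smooth_vfield \<A> U X" "smooth_vfield \<A> U Y" "p \<in> U"
  shows "lie_bracket \<A> X Y p = D X Y p - D Y X p"
  using kaehler assms by (simp add: kaehler_manifold_def levi_civita_def)

lemma linear_A: "linear (A p)"
  using kaehler by (simp add: kaehler_manifold_def tensor_field11_def)

lemma smooth_vfield_A: "open U \<Longrightarrow> smooth_vfield \<A> U X \<Longrightarrow> smooth_vfield \<A> U (\<lambda>q. A q (X q))"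
  using kaehler by (simp add: kaehler_manifold_def tensor_field11_def)

lemma A_A: "A p (A p v) = - v"
  using kaehler by (simp add: kaehler_manifold_def)

lemma A_parallel:
  assumes "open U" "smooth_vfield \<A> U X" "smooth_vfield \<A> U Y" "p \<in> U"
  shows "D X (\<lambda>q. A q (Y q)) p = A p (D X Y p)"
proof -
  have "\<forall>U X Y. open U \<and> smooth_vfield \<A> U X \<and> smooth_vfield \<A> U Y \<longrightarrow>
      (\<forall>p\<in>U. D X (\<lambda>q. A q (Y q)) p - A p (D X Y p) = 0)"
    using kaehler unfolding kaehler_manifold_def by (elim conjE)
  then show ?thesis using assms by simp
qed

text \<open>Leibniz rule for \<open>D X\<close>, with parallelism moving \<open>A\<close> past it.
  Only the inner connection is expanded here; the outer generator term is algebraic at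
  \<open>p\<close> and enters in \<open>curvature_conn1\<close>.\<close>

lemma connection_conn1:
  assumes "one_form \<A> \<pi>" "open U" "p \<in> U"
    and "smooth_vfield \<A> U X" "smooth_vfield \<A> U Y" "smooth_vfield \<A> U Z"
  shows "D X (conn1 D A \<pi> Y Z) p =
    D X (D Y Z) p - act \<A> X (\<lambda>q. \<pi> q (Y q)) p *\<^sub>R A p (Z p) - \<pi> p (Y p) *\<^sub>R A p (D X Z p)"
proof -
  let ?W = "\<lambda>q. A q (A q (A q (Z q)))"
  have pi: "smooth_fun \<A> U (\<lambda>q. \<pi> q (Y q))"
    using assms by (simp add: one_form_def)
  have AZ: "smooth_vfield \<A> U (\<lambda>q. A q (Z q))" "smooth_vfield \<A> U (\<lambda>q. A q (A q (Z q)))"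
    "smooth_vfield \<A> U ?W"
    using smooth_vfield_A assms by blast+
  \<comment> \<open>writing \<open>- A\<close> as \<open>A\<^sup>3\<close> makes smoothness and parallelism of the sign immediate\<close>
  have "conn1 D A \<pi> Y Z = (\<lambda>q. D Y Z q + \<pi> q (Y q) *\<^sub>R ?W q)"
    by (simp add: fun_eq_iff conn1_def A_A linear_neg[OF linear_A])
  then have "D X (conn1 D A \<pi> Y Z) p = D X (D Y Z) p + D X (\<lambda>q. \<pi> q (Y q) *\<^sub>R ?W q) p"
    using affine_connectionD(1,3)[OF connection] smooth_vfield_scaleR[OF pi AZ(3)] assms by simp
  also have "D X (\<lambda>q. \<pi> q (Y q) *\<^sub>R ?W q) p =
      act \<A> X (\<lambda>q. \<pi> q (Y q)) p *\<^sub>R ?W p + \<pi> p (Y p) *\<^sub>R D X ?W p"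
    using affine_connectionD(5)[OF connection assms(2,4) AZ(3) pi assms(3)] .
  also have "D X ?W p = A p (A p (A p (D X Z p)))"
    using A_parallel[OF assms(2,4) _ assms(3)] AZ assms(6) by simp
  finally show ?thesis by (simp add: A_A linear_neg[OF linear_A])
qed

text \<open>Besides the quadratic terms, the mixed terms \<pi>(Y) A(D_X Z) + \<pi>(X) A(D_Y Z) are
  symmetric in \<open>X\<close> and \<open>Y\<close> and cancel. The derivatives of \<pi>(Y) and
  \<pi>(X) combine with the bracket term into \<open>ext_deriv\<close>.\<close>

lemma curvature_conn1:
  assumes "one_form \<A> \<pi>" "open U" "p \<in> U"
    and "smooth_vfield \<A> U X" "smooth_vfield \<A> U Y" "smooth_vfield \<A> U Z"
  shows "curvature \<A> (conn1 D A \<pi>) X Y Z p =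
    curvature \<A> D X Y Z p - ext_deriv \<A> \<pi> X Y p *\<^sub>R A p (Z p)"
proof -
  have outer: "conn1 D A \<pi> V W p = D V W p - \<pi> p (V p) *\<^sub>R A p (W p)" for V W
    by (simp add: conn1_def)
  show ?thesis
    unfolding curvature_def ext_deriv_def outer
      connection_conn1[OF assms(1-6)] connection_conn1[OF assms(1-3,5,4,6)]
    by (simp add: linear_diff[OF linear_A] linear_scale[OF linear_A] A_A algebra_simps)
qed

text \<open>Tensoriality in the first slot: when \<open>W\<close> is scaled by \<open>f\<close>, the
  term Y(f) \<pi>(W) from the product rule cancels against the one from the bracket.
  Torsion-freeness rewrites the bracket through \<open>D\<close>, whose axioms then supply its
  additivity and its Leibniz rule.\<close>

lemma ext_deriv_expansion:
  assumes "one_form \<A> \<pi>" and U: "open U" "p \<in> U"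
    and X: "smooth_vfield \<A> U X" and Y: "smooth_vfield \<A> U Y"
  shows "ext_deriv \<A> \<pi> X Y p =
    (\<Sum>i\<in>UNIV. X p $ i * ext_deriv \<A> \<pi> (extend_vector \<A> p (axis i 1)) Y p)"
proof (rule tensorial_expansion[OF _ _ U X])
  have lin: "linear (\<pi> q)" for q using assms(1) by (simp add: one_form_def)
  have pi: "smooth_fun \<A> V (\<lambda>q. \<pi> q (W q))" if "open V" "smooth_vfield \<A> V W" for V W
    using assms(1) that by (simp add: one_form_def)
  fix V W assume V: "open V" "p \<in> V" "V \<subseteq> U" and W: "smooth_vfield \<A> V W"
  have YV: "smooth_vfield \<A> V Y" using smooth_vfield_subset[OF Y V(3)] .
  note conn = affine_connectionD[OF connection V(1)]
  {
    fix W' assume W': "smooth_vfield \<A> V W'"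
    have "act \<A> Y (\<lambda>q. \<pi> q (W q + W' q)) p =
        act \<A> Y (\<lambda>q. \<pi> q (W q)) p + act \<A> Y (\<lambda>q. \<pi> q (W' q)) p"
      using dir_deriv_add[OF V(1,2) pi[OF V(1) W] pi[OF V(1) W']] by (simp add: act_def linear_add[OF lin])
    then show "ext_deriv \<A> \<pi> (\<lambda>q. W q + W' q) Y p = ext_deriv \<A> \<pi> W Y p + ext_deriv \<A> \<pi> W' Y p"
      using act_add_left[OF V(1,2) pi[OF V(1) YV]] conn(2)[OF W YV W' V(2)] conn(3)[OF YV W W' V(2)]
      by (simp add: ext_deriv_def linear_add[OF lin] linear_diff[OF lin] W W' YV V
          torsion_free[OF V(1) _ _ V(2)] smooth_vfield_add)
  next
    fix f assume f: "smooth_fun \<A> V f"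
    have "act \<A> Y (\<lambda>q. \<pi> q (f q *\<^sub>R W q)) p =
        f p * act \<A> Y (\<lambda>q. \<pi> q (W q)) p + act \<A> Y f p * \<pi> p (W p)"
      using dir_deriv_mult[OF V(1,2) f pi[OF V(1) W]] by (simp add: act_def linear_scale[OF lin])
    then show "ext_deriv \<A> \<pi> (\<lambda>q. f q *\<^sub>R W q) Y p = f p * ext_deriv \<A> \<pi> W Y p"
      using act_scaleR_left[OF V(1,2) pi[OF V(1) YV]] conn(4)[OF W YV f V(2)] conn(5)[OF YV W f V(2)]
      by (simp add: ext_deriv_def linear_add[OF lin] linear_diff[OF lin] linear_scale[OF lin] W YV V f
          torsion_free[OF V(1) _ _ V(2)] smooth_vfield_scaleR algebra_simps)
  }
qed

text \<open>The right-hand side is the same tensor formed from the Levi-Civita connection, and \<pi>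
  does not occur in it.\<close>

lemma H1_conn1:
  assumes "one_form \<A> \<pi>" "open U" "p \<in> U"
    and "smooth_vfield \<A> U X" "smooth_vfield \<A> U Y" "smooth_vfield \<A> U Z"
  shows "H1 \<A> D A \<pi> X Y Z p =
    curvature \<A> D X Y Z p + ricci \<A> D Y (\<lambda>q. A q (X q)) p *\<^sub>R A p (Z p)"
proof -
  let ?e = "\<lambda>i. extend_vector \<A> p (axis i (1::real))"
  have "curvature \<A> (conn1 D A \<pi>) (?e i) Y (\<lambda>q. A q (X q)) p =
      curvature \<A> D (?e i) Y (\<lambda>q. A q (X q)) p + ext_deriv \<A> \<pi> (?e i) Y p *\<^sub>R X p" for i
  proof -
    obtain V where V: "open V" "p \<in> V" "smooth_vfield \<A> V (?e i)" by (rule extend_vector)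
    have "curvature \<A> (conn1 D A \<pi>) (?e i) Y (\<lambda>q. A q (X q)) p =
      curvature \<A> D (?e i) Y (\<lambda>q. A q (X q)) p - ext_deriv \<A> \<pi> (?e i) Y p *\<^sub>R A p (A p (X p))"
    proof (rule curvature_conn1[OF assms(1)])
      \<comment> \<open>The extension of a basis vector is known to be smooth only on
        \<open>V\<close>, so the curvature formula is applied on the overlap with
        \<open>U\<close>.\<close>
      show "open (U \<inter> V)" "p \<in> U \<inter> V" using V assms by auto
      show "smooth_vfield \<A> (U \<inter> V) (?e i)" "smooth_vfield \<A> (U \<inter> V) Y"
        "smooth_vfield \<A> (U \<inter> V) (\<lambda>q. A q (X q))"
        using V(3) assms smooth_vfield_A smooth_vfield_subset by (meson inf_le1 inf_le2)+
    qed
    then show ?thesis by (simp add: A_A)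
  qed
  \<comment> \<open>The i-th diagonal entry picks the i-th component of the extra multiple of
    \<open>X p\<close>; their sum is exactly the expansion of \<open>ext_deriv\<close> at
    \<open>X\<close>.\<close>
  then have "ricci \<A> (conn1 D A \<pi>) Y (\<lambda>q. A q (X q)) p =
      ricci \<A> D Y (\<lambda>q. A q (X q)) p + (\<Sum>i\<in>UNIV. X p $ i * ext_deriv \<A> \<pi> (?e i) Y p)"
    by (simp add: ricci_def trace_def matrix_def sum.distrib mult.commute)
  then have "ricci \<A> (conn1 D A \<pi>) Y (\<lambda>q. A q (X q)) p =
      ricci \<A> D Y (\<lambda>q. A q (X q)) p + ext_deriv \<A> \<pi> X Y p"
    using ext_deriv_expansion[OF assms(1-5)] by simp
  then show ?thesis
    unfolding H1_def curvature_conn1[OF assms] by (simp add: scaleR_add_left)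
qed

end

theorem theorem4p1:
  fixes \<A> :: "('m::{t2_space, second_countable_topology}, 'n::finite) chart set"
    and g :: "('m, 'n) tensor02" and A :: "('m, 'n) tensor11"
    and D :: "('m, 'n) connection"
    and \<pi> \<pi>' :: "('m, 'n) form1"
    and U :: "'m set" and X Y Z :: "('m, 'n) vfield" and p :: 'm
  assumes "kaehler_manifold \<A> g A D"
    and "one_form \<A> \<pi>" and "one_form \<A> \<pi>'"
    and "open U" and "smooth_vfield \<A> U X" and "smooth_vfield \<A> U Y" and "smooth_vfield \<A> U Z"
    and "p \<in> U"
  shows "H1 \<A> D A \<pi> X Y Z p = H1 \<A> D A \<pi>' X Y Z p"
proof -
  interpret kaehler \<A> g A D by unfold_locales (rule assms(1))
  show ?thesis
    using H1_conn1[OF assms(2,4,8,5-7)] H1_conn1[OF assms(3,4,8,5-7)] by simp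
qed

end
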